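(* Existentially set-guarded (ESG) sentences are preserved in subset-consistent substructures. That is, if $\mathfrak{B}$ is a structure for set preferences, $\mathfrak{A}$ is a subset-consistent substructure of $\mathfrak{B}$, and $\varphi$ is any ESG sentence, then $\mathfrak{B} \models \varphi$ implies $\mathfrak{A} \models \varphi$.
   Context: MSLSP (many-sorted logic for set preferences) is the many-sorted first-order language (with equality) with two sorts, $\varepsilon$ (elements) and $\sigma$ (sets), and the following signature. Relation symbols: $\in$ of type $\langle\varepsilon,\sigma\rangle$; $\dot{\geq}$ of type $\langle\varepsilon,\varepsilon\rangle$; $\succeq$ of type $\langle\sigma,\sigma\rangle$; $\subseteq$ of type $\langle\sigma,\sigma\rangle$; $\mathrm{disjoint}$ of type $\langle\sigma,\sigma\rangle$; $\mathrm{evencard}$ of type $\langle\sigma\rangle$; $\mathrm{equalcard}$ of type $\langle\sigma,\sigma\rangle$. Function symbols: $\cup$, taking two arguments of sort $\sigma$ to sort $\sigma$; $\{\cdot\}$, taking an argument of sort $\varepsilon$ to sort $\sigma$; $\mathrm{replaceInBy}$, taking arguments of sorts $\varepsilon,\sigma,\varepsilon$ to sort $\sigma$. A structure $\mathfrak{A}$ has a separate domain $\mathrm{dom}_s(\mathfrak{A})$ for each sort $s\in\{\varepsilon,\sigma\}$, and the quantifiers $\forall_s,\exists_s$ range over $\mathrm{dom}_s(\mathfrak{A})$. Substructures are understood in the usual (many-sorted) model-theoretic sense: the domains are subsets of the corresponding domains, closed under the functions, and all relations and functions are restrictions. An MSLSP-structure $\mathfrak{B}$ is a *structure for set preferences*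 if (1) $\mathrm{dom}_\sigma(\mathfrak{B}) \subseteq 2^{\mathrm{dom}_\varepsilon(\mathfrak{B})}$, i.e. the domain of sort $\sigma$ contains only sets of elements of the domain of sort $\varepsilon$, and (2) the relation symbol $\in$ is interpreted as actual membership. A substructure $\mathfrak{A}$ of a structure for set preferences $\mathfrak{B}$ is called *subset-consistent* if $\mathfrak{A}$ is itself a structure for set preferences. The class of *existentially set-guarded* (ESG) formulas is the smallest class of MSLSP-formulas such that: - all quantifier-free formulas are ESG; - if $\psi(\bar{x})$ and $\psi'(\bar{x})$ are ESG, then $(\psi\wedge\psi')(\bar{x})$ and $(\psi\vee\psi')(\bar{x})$ are ESG; - if $\psi(y,\bar{x})$ is ESG, then $\forall_s y\,\psi(y,\bar{x})$ is ESG for any sort $s\in\{\varepsilon,\sigma\}$; - if $\psi(y,\bar{x})$ is ESG, then $\exists_\varepsilon y\,(y\in t(\bar{x})\wedge\psi(y,\bar{x}))$ is ESG, where $t$ is a term of sort $\sigma$ and $y$ (a variable of sort $\varepsilon$) does not occur in $\bar{x}$. Writing $\varphi(\bar{x})$ means that all free variables of $\varphi$ are among $\bar{x}$. A sentence is a formula without free variables. *)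

theory Defs
  imports Main
begin

section \<open>Syntax of MSLSP\<close>

text \<open>
  The signature is fixed, so well-sorted syntax is built into the datatypes. Variables of the
  two sorts live in separate name spaces. No function symbol has result sort \<open>\<epsilon>\<close>, hence the only
  terms of sort \<open>\<epsilon>\<close> are variables. Implication and equivalence are the usual abbreviations in
  terms of negation, conjunction and disjunction.
\<close>

datatype eterm = EVar nat

datatype sterm =
    SVar nat
  | Cup sterm sterm
  | Sing eterm
  | ReplaceInBy eterm sterm eterm

datatype fm =
    EqE eterm eterm
  | EqS sterm sterm
  | Mem eterm sterm
  | GeqE eterm eterm
  | PrefS sterm sterm
  | SubsetS sterm sterm
  | DisjointS sterm sterm
  | Evencard sterm
  | Equalcard sterm sterm
  | Neg fm
  | Conj fm fm
  | Disj fm fm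
  | AllE nat fm
  | AllS nat fm
  | ExE nat fm
  | ExS nat fm

primrec evars_eterm :: "eterm \<Rightarrow> nat set" where
  "evars_eterm (EVar x) = {x}"

primrec evars_sterm :: "sterm \<Rightarrow> nat set" where
  "evars_sterm (SVar X) = {}"
| "evars_sterm (Cup s t) = evars_sterm s \<union> evars_sterm t"
| "evars_sterm (Sing a) = evars_eterm a"
| "evars_sterm (ReplaceInBy a s b) = evars_eterm a \<union> evars_sterm s \<union> evars_eterm b"

primrec svars_sterm :: "sterm \<Rightarrow> nat set" where
  "svars_sterm (SVar X) = {X}"
| "svars_sterm (Cup s t) = svars_sterm s \<union> svars_sterm t"
| "svars_sterm (Sing a) = {}"
| "svars_sterm (ReplaceInBy a s b) = svars_sterm s"

primrec free_evars :: "fm \<Rightarrow> nat set" where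
  "free_evars (EqE a b) = evars_eterm a \<union> evars_eterm b"
| "free_evars (EqS s t) = evars_sterm s \<union> evars_sterm t"
| "free_evars (Mem a t) = evars_eterm a \<union> evars_sterm t"
| "free_evars (GeqE a b) = evars_eterm a \<union> evars_eterm b"
| "free_evars (PrefS s t) = evars_sterm s \<union> evars_sterm t"
| "free_evars (SubsetS s t) = evars_sterm s \<union> evars_sterm t"
| "free_evars (DisjointS s t) = evars_sterm s \<union> evars_sterm t"
| "free_evars (Evencard s) = evars_sterm s"
| "free_evars (Equalcard s t) = evars_sterm s \<union> evars_sterm t"
| "free_evars (Neg \<phi>) = free_evars \<phi>"
| "free_evars (Conj \<phi> \<psi>) = free_evars \<phi> \<union> free_evars \<psi>"
| "free_evars (Disj \<phi> \<psi>) = free_evars \<phi> \<union> free_evars \<psi>"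
| "free_evars (AllE x \<phi>) = free_evars \<phi> - {x}"
| "free_evars (AllS X \<phi>) = free_evars \<phi>"
| "free_evars (ExE x \<phi>) = free_evars \<phi> - {x}"
| "free_evars (ExS X \<phi>) = free_evars \<phi>"

primrec free_svars :: "fm \<Rightarrow> nat set" where
  "free_svars (EqE a b) = {}"
| "free_svars (EqS s t) = svars_sterm s \<union> svars_sterm t"
| "free_svars (Mem a t) = svars_sterm t"
| "free_svars (GeqE a b) = {}"
| "free_svars (PrefS s t) = svars_sterm s \<union> svars_sterm t"
| "free_svars (SubsetS s t) = svars_sterm s \<union> svars_sterm t"
| "free_svars (DisjointS s t) = svars_sterm s \<union> svars_sterm t"
| "free_svars (Evencard s) = svars_sterm s"
| "free_svars (Equalcard s t) = svars_sterm s \<union> svars_sterm t"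
| "free_svars (Neg \<phi>) = free_svars \<phi>"
| "free_svars (Conj \<phi> \<psi>) = free_svars \<phi> \<union> free_svars \<psi>"
| "free_svars (Disj \<phi> \<psi>) = free_svars \<phi> \<union> free_svars \<psi>"
| "free_svars (AllE x \<phi>) = free_svars \<phi>"
| "free_svars (AllS X \<phi>) = free_svars \<phi> - {X}"
| "free_svars (ExE x \<phi>) = free_svars \<phi>"
| "free_svars (ExS X \<phi>) = free_svars \<phi> - {X}"

definition sentence :: "fm \<Rightarrow> bool" where
  "sentence \<phi> \<longleftrightarrow> free_evars \<phi> = {} \<and> free_svars \<phi> = {}"

primrec quantifier_free :: "fm \<Rightarrow> bool" where
  "quantifier_free (EqE a b) \<longleftrightarrow> True"
| "quantifier_free (EqS s t) \<longleftrightarrow> True"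
| "quantifier_free (Mem a t) \<longleftrightarrow> True"
| "quantifier_free (GeqE a b) \<longleftrightarrow> True"
| "quantifier_free (PrefS s t) \<longleftrightarrow> True"
| "quantifier_free (SubsetS s t) \<longleftrightarrow> True"
| "quantifier_free (DisjointS s t) \<longleftrightarrow> True"
| "quantifier_free (Evencard s) \<longleftrightarrow> True"
| "quantifier_free (Equalcard s t) \<longleftrightarrow> True"
| "quantifier_free (Neg \<phi>) \<longleftrightarrow> quantifier_free \<phi>"
| "quantifier_free (Conj \<phi> \<psi>) \<longleftrightarrow> quantifier_free \<phi> \<and> quantifier_free \<psi>"
| "quantifier_free (Disj \<phi> \<psi>) \<longleftrightarrow> quantifier_free \<phi> \<and> quantifier_free \<psi>"
| "quantifier_free (AllE x \<phi>) \<longleftrightarrow> False"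
| "quantifier_free (AllS X \<phi>) \<longleftrightarrow> False"
| "quantifier_free (ExE x \<phi>) \<longleftrightarrow> False"
| "quantifier_free (ExS X \<phi>) \<longleftrightarrow> False"

text \<open>
  In \<open>ESG_ExE\<close> the guard term must not contain the quantified variable; without this side
  condition the guard \<open>y \<in> {y}\<close> would be vacuous.
\<close>

inductive ESG :: "fm \<Rightarrow> bool" where
  ESG_qf: "quantifier_free \<phi> \<Longrightarrow> ESG \<phi>"
| ESG_Conj: "ESG \<phi> \<Longrightarrow> ESG \<psi> \<Longrightarrow> ESG (Conj \<phi> \<psi>)"
| ESG_Disj: "ESG \<phi> \<Longrightarrow> ESG \<psi> \<Longrightarrow> ESG (Disj \<phi> \<psi>)"
| ESG_AllE: "ESG \<psi> \<Longrightarrow> ESG (AllE y \<psi>)"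
| ESG_AllS: "ESG \<psi> \<Longrightarrow> ESG (AllS Y \<psi>)"
| ESG_ExE: "ESG \<psi> \<Longrightarrow> y \<notin> evars_sterm t \<Longrightarrow> ESG (ExE y (Conj (Mem (EVar y) t) \<psi>))"


section \<open>Structures\<close>

text \<open>
  The two sorts are carried by independent types; the domains are subsets of these types. Only
  the values of the relations and functions on the domains are relevant.
\<close>

record ('e, 's) mslsp =
  dom_e :: "'e set"
  dom_s :: "'s set"
  mem_rel :: "'e \<Rightarrow> 's \<Rightarrow> bool"
  geq_rel :: "'e \<Rightarrow> 'e \<Rightarrow> bool"
  pref_rel :: "'s \<Rightarrow> 's \<Rightarrow> bool"
  subset_rel :: "'s \<Rightarrow> 's \<Rightarrow> bool"
  disjoint_rel :: "'s \<Rightarrow> 's \<Rightarrow> bool"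
  evencard_rel :: "'s \<Rightarrow> bool"
  equalcard_rel :: "'s \<Rightarrow> 's \<Rightarrow> bool"
  cup_fun :: "'s \<Rightarrow> 's \<Rightarrow> 's"
  sing_fun :: "'e \<Rightarrow> 's"
  replace_fun :: "'e \<Rightarrow> 's \<Rightarrow> 'e \<Rightarrow> 's"

definition is_mslsp_structure :: "('e, 's) mslsp \<Rightarrow> bool" where
  "is_mslsp_structure M \<longleftrightarrow>
     (\<forall>S\<in>dom_s M. \<forall>T\<in>dom_s M. cup_fun M S T \<in> dom_s M) \<and>
     (\<forall>a\<in>dom_e M. sing_fun M a \<in> dom_s M) \<and>
     (\<forall>a\<in>dom_e M. \<forall>S\<in>dom_s M. \<forall>b\<in>dom_e M. replace_fun M a S b \<in> dom_s M)"

definition substructure :: "('e, 's) mslsp \<Rightarrow> ('e, 's) mslsp \<Rightarrow> bool" where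
  "substructure A B \<longleftrightarrow>
     is_mslsp_structure A \<and> is_mslsp_structure B \<and>
     dom_e A \<subseteq> dom_e B \<and> dom_s A \<subseteq> dom_s B \<and>
     (\<forall>a\<in>dom_e A. \<forall>S\<in>dom_s A. mem_rel A a S \<longleftrightarrow> mem_rel B a S) \<and>
     (\<forall>a\<in>dom_e A. \<forall>b\<in>dom_e A. geq_rel A a b \<longleftrightarrow> geq_rel B a b) \<and>
     (\<forall>S\<in>dom_s A. \<forall>T\<in>dom_s A. pref_rel A S T \<longleftrightarrow> pref_rel B S T) \<and>
     (\<forall>S\<in>dom_s A. \<forall>T\<in>dom_s A. subset_rel A S T \<longleftrightarrow> subset_rel B S T) \<and>
     (\<forall>S\<in>dom_s A. \<forall>T\<in>dom_s A. disjoint_rel A S T \<longleftrightarrow> disjoint_rel B S T) \<and>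
     (\<forall>S\<in>dom_s A. evencard_rel A S \<longleftrightarrow> evencard_rel B S) \<and>
     (\<forall>S\<in>dom_s A. \<forall>T\<in>dom_s A. equalcard_rel A S T \<longleftrightarrow> equalcard_rel B S T) \<and>
     (\<forall>S\<in>dom_s A. \<forall>T\<in>dom_s A. cup_fun A S T = cup_fun B S T) \<and>
     (\<forall>a\<in>dom_e A. sing_fun A a = sing_fun B a) \<and>
     (\<forall>a\<in>dom_e A. \<forall>S\<in>dom_s A. \<forall>b\<in>dom_e A. replace_fun A a S b = replace_fun B a S b)"

text \<open>
  Only the symbol for membership receives its intended interpretation; the remaining symbols
  (including union, singleton and inclusion) are left uninterpreted.
\<close>

definition set_pref_structure :: "('e, 'e set) mslsp \<Rightarrow> bool" where
  "set_pref_structure M \<longleftrightarrow>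
     is_mslsp_structure M \<and>
     dom_s M \<subseteq> Pow (dom_e M) \<and>
     (\<forall>a\<in>dom_e M. \<forall>S\<in>dom_s M. mem_rel M a S \<longleftrightarrow> a \<in> S)"

definition subset_consistent_substructure ::
    "('e, 'e set) mslsp \<Rightarrow> ('e, 'e set) mslsp \<Rightarrow> bool" where
  "subset_consistent_substructure A B \<longleftrightarrow> substructure A B \<and> set_pref_structure A"


section \<open>Semantics\<close>

primrec eval_e :: "(nat \<Rightarrow> 'e) \<Rightarrow> eterm \<Rightarrow> 'e" where
  "eval_e u (EVar x) = u x"

primrec eval_s :: "('e, 's) mslsp \<Rightarrow> (nat \<Rightarrow> 'e) \<Rightarrow> (nat \<Rightarrow> 's) \<Rightarrow> sterm \<Rightarrow> 's" where
  "eval_s M u U (SVar X) = U X"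
| "eval_s M u U (Cup s t) = cup_fun M (eval_s M u U s) (eval_s M u U t)"
| "eval_s M u U (Sing a) = sing_fun M (eval_e u a)"
| "eval_s M u U (ReplaceInBy a s b) =
     replace_fun M (eval_e u a) (eval_s M u U s) (eval_e u b)"

primrec sat :: "('e, 's) mslsp \<Rightarrow> (nat \<Rightarrow> 'e) \<Rightarrow> (nat \<Rightarrow> 's) \<Rightarrow> fm \<Rightarrow> bool" where
  "sat M u U (EqE a b) \<longleftrightarrow> eval_e u a = eval_e u b"
| "sat M u U (EqS s t) \<longleftrightarrow> eval_s M u U s = eval_s M u U t"
| "sat M u U (Mem a t) \<longleftrightarrow> mem_rel M (eval_e u a) (eval_s M u U t)"
| "sat M u U (GeqE a b) \<longleftrightarrow> geq_rel M (eval_e u a) (eval_e u b)"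
| "sat M u U (PrefS s t) \<longleftrightarrow> pref_rel M (eval_s M u U s) (eval_s M u U t)"
| "sat M u U (SubsetS s t) \<longleftrightarrow> subset_rel M (eval_s M u U s) (eval_s M u U t)"
| "sat M u U (DisjointS s t) \<longleftrightarrow> disjoint_rel M (eval_s M u U s) (eval_s M u U t)"
| "sat M u U (Evencard s) \<longleftrightarrow> evencard_rel M (eval_s M u U s)"
| "sat M u U (Equalcard s t) \<longleftrightarrow> equalcard_rel M (eval_s M u U s) (eval_s M u U t)"
| "sat M u U (Neg \<phi>) \<longleftrightarrow> \<not> sat M u U \<phi>"
| "sat M u U (Conj \<phi> \<psi>) \<longleftrightarrow> sat M u U \<phi> \<and> sat M u U \<psi>"
| "sat M u U (Disj \<phi> \<psi>) \<longleftrightarrow> sat M u U \<phi> \<or> sat M u U \<psi>"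
| "sat M u U (AllE x \<phi>) \<longleftrightarrow> (\<forall>a\<in>dom_e M. sat M (u(x := a)) U \<phi>)"
| "sat M u U (AllS X \<phi>) \<longleftrightarrow> (\<forall>S\<in>dom_s M. sat M u (U(X := S)) \<phi>)"
| "sat M u U (ExE x \<phi>) \<longleftrightarrow> (\<exists>a\<in>dom_e M. sat M (u(x := a)) U \<phi>)"
| "sat M u U (ExS X \<phi>) \<longleftrightarrow> (\<exists>S\<in>dom_s M. sat M u (U(X := S)) \<phi>)"

text \<open>
  Truth is only used for sentences, whose satisfaction does not depend on the assignment
  (see \<open>models_iff_sat\<close> below). Assignments are therefore not required to take values in the
  domains; this keeps the notion meaningful also if a domain is empty.
\<close>

definition models :: "('e, 's) mslsp \<Rightarrow> fm \<Rightarrow> bool" (infix "\<Turnstile>" 50) where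
  "M \<Turnstile> \<phi> \<longleftrightarrow> (\<forall>u U. sat M u U \<phi>)"

lemma eval_e_cong:
  "(\<And>x. x \<in> evars_eterm a \<Longrightarrow> u x = v x) \<Longrightarrow> eval_e u a = eval_e v a"
  by (cases a) simp

lemma eval_s_cong:
  assumes "\<And>x. x \<in> evars_sterm t \<Longrightarrow> u x = v x"
    and "\<And>X. X \<in> svars_sterm t \<Longrightarrow> U X = V X"
  shows "eval_s M u U t = eval_s M v V t"
  using assms
proof (induction t)
  case (Sing a)
  then show ?case using eval_e_cong[of a u v] by simp
next
  case (ReplaceInBy a s b)
  then show ?case using eval_e_cong[of a u v] eval_e_cong[of b u v] by simp
qed simp_all

lemma sat_cong:
  assumes "\<And>x. x \<in> free_evars \<phi> \<Longrightarrow> u x = v x"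
    and "\<And>X. X \<in> free_svars \<phi> \<Longrightarrow> U X = V X"
  shows "sat M u U \<phi> \<longleftrightarrow> sat M v V \<phi>"
  using assms
proof (induction \<phi> arbitrary: u v U V)
  case (EqE a b)
  then show ?case using eval_e_cong[of a u v] eval_e_cong[of b u v] by simp
next
  case (EqS s t)
  then show ?case using eval_s_cong[of s u v U V M] eval_s_cong[of t u v U V M] by simp
next
  case (Mem a t)
  then show ?case using eval_e_cong[of a u v] eval_s_cong[of t u v U V M] by simp
next
  case (GeqE a b)
  then show ?case using eval_e_cong[of a u v] eval_e_cong[of b u v] by simp
next
  case (PrefS s t)
  then show ?case using eval_s_cong[of s u v U V M] eval_s_cong[of t u v U V M] by simp
next
  case (SubsetS s t)
  then show ?case using eval_s_cong[of s u v U V M] eval_s_cong[of t u v U V M] by simp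
next
  case (DisjointS s t)
  then show ?case using eval_s_cong[of s u v U V M] eval_s_cong[of t u v U V M] by simp
next
  case (Evencard s)
  then show ?case using eval_s_cong[of s u v U V M] by simp
next
  case (Equalcard s t)
  then show ?case using eval_s_cong[of s u v U V M] eval_s_cong[of t u v U V M] by simp
next
  case (Neg \<phi>)
  have "sat M u U \<phi> \<longleftrightarrow> sat M v V \<phi>" by (rule Neg.IH) (simp_all add: Neg.prems)
  then show ?case by simp
next
  case (Conj \<phi> \<psi>)
  have "sat M u U \<phi> \<longleftrightarrow> sat M v V \<phi>" by (rule Conj.IH(1)) (simp_all add: Conj.prems)
  moreover have "sat M u U \<psi> \<longleftrightarrow> sat M v V \<psi>" by (rule Conj.IH(2)) (simp_all add: Conj.prems)
  ultimately show ?case by simp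
next
  case (Disj \<phi> \<psi>)
  have "sat M u U \<phi> \<longleftrightarrow> sat M v V \<phi>" by (rule Disj.IH(1)) (simp_all add: Disj.prems)
  moreover have "sat M u U \<psi> \<longleftrightarrow> sat M v V \<psi>" by (rule Disj.IH(2)) (simp_all add: Disj.prems)
  ultimately show ?case by simp
next
  case (AllE x \<phi>)
  have "sat M (u(x := a)) U \<phi> \<longleftrightarrow> sat M (v(x := a)) V \<phi>" for a
    by (rule AllE.IH) (simp_all add: AllE.prems)
  then show ?case by simp
next
  case (AllS X \<phi>)
  have "sat M u (U(X := S)) \<phi> \<longleftrightarrow> sat M v (V(X := S)) \<phi>" for S
    by (rule AllS.IH) (simp_all add: AllS.prems)
  then show ?case by simp
next
  case (ExE x \<phi>)
  have "sat M (u(x := a)) U \<phi> \<longleftrightarrow> sat M (v(x := a)) V \<phi>" for a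
    by (rule ExE.IH) (simp_all add: ExE.prems)
  then show ?case by simp
next
  case (ExS X \<phi>)
  have "sat M u (U(X := S)) \<phi> \<longleftrightarrow> sat M v (V(X := S)) \<phi>" for S
    by (rule ExS.IH) (simp_all add: ExS.prems)
  then show ?case by simp
qed

lemma models_iff_sat: "sentence \<phi> \<Longrightarrow> M \<Turnstile> \<phi> \<longleftrightarrow> sat M u U \<phi>"
  unfolding models_def sentence_def using sat_cong[of \<phi> _ u _ U M] by blast

end

theory Submission
  imports Defs
begin

text \<open>
  By induction, an ESG formula that holds in \<open>B\<close> under an assignment into \<open>A\<close> holds in \<open>A\<close>. For
  a guarded existential quantifier the guard term denotes a set in the domain of \<open>A\<close>; as \<open>A\<close> is
  itself a structure for set preferences, this set is contained in the element domain of \<open>A\<close>, and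
  so any witness found in \<open>B\<close> already lies in \<open>A\<close>.
\<close>

lemma eval_e_in_dom:
  "\<forall>x\<in>evars_eterm a. u x \<in> D \<Longrightarrow> eval_e u a \<in> D"
  by (cases a) simp

lemma eval_s_in_dom:
  assumes "is_mslsp_structure M"
    and "\<forall>x\<in>evars_sterm t. u x \<in> dom_e M" and "\<forall>X\<in>svars_sterm t. U X \<in> dom_s M"
  shows "eval_s M u U t \<in> dom_s M"
  using assms by (induction t) (auto simp: is_mslsp_structure_def eval_e_in_dom)

text \<open>The functions of \<open>A\<close> and \<open>B\<close> need only agree on the domains of
  \<open>A\<close>, so each induction step relies on the values of the subterms lying there.\<close>

lemma eval_s_substructure:
  assumes "substructure A B"
    and "\<forall>x\<in>evars_sterm t. u x \<in> dom_e A" and "\<forall>X\<in>svars_sterm t. U X \<in> dom_s A"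
  shows "eval_s A u U t = eval_s B u U t"
proof -
  have "is_mslsp_structure A" using assms(1) by (simp add: substructure_def)
  note dom = eval_s_in_dom[OF this]
  from assms show ?thesis
  proof (induction t)
    case (Cup s t)
    then show ?case
      using dom[of s u U] dom[of t u U] by (simp add: substructure_def)
  next
    case (Sing a)
    then show ?case by (simp add: substructure_def eval_e_in_dom)
  next
    case (ReplaceInBy a s b)
    then show ?case
      using dom[of s u U] by (simp add: substructure_def eval_e_in_dom)
  qed simp
qed

text \<open>An equivalence, because negation swaps the two directions. For atoms, the terms have the
  same values in \<open>A\<close> and \<open>B\<close>, and these lie in the domains of
  \<open>A\<close>, where the relations agree.\<close>

lemma sat_quantifier_free_substructure:
  assumes "substructure A B" and "quantifier_free \<phi>"
    and "\<forall>x\<in>free_evars \<phi>. u x \<in> dom_e A" and "\<forall>X\<in>free_svars \<phi>. U X \<in> dom_s A"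
  shows "sat A u U \<phi> \<longleftrightarrow> sat B u U \<phi>"
proof -
  have "is_mslsp_structure A" using assms(1) by (simp add: substructure_def)
  note [simp] = eval_s_in_dom[OF this, of _ u U] eval_e_in_dom[of _ u "dom_e A"]
    eval_s_substructure[OF assms(1), of _ u U, symmetric]
  from assms show ?thesis
    by (induction \<phi>) (simp_all add: substructure_def)
qed

text \<open>Open formulas are needed for the induction to pass below quantifiers. Only values at
  free variables are restricted, so a sentence meets the conditions under every assignment, even if
  a domain of \<open>A\<close> is empty.\<close>

lemma sat_ESG_subset_consistent_substructure:
  assumes B: "set_pref_structure B" and sub: "subset_consistent_substructure A B"
    and "ESG \<phi>"
    and "\<forall>x\<in>free_evars \<phi>. u x \<in> dom_e A" and "\<forall>X\<in>free_svars \<phi>. U X \<in> dom_s A"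
    and "sat B u U \<phi>"
  shows "sat A u U \<phi>"
  using assms(3-)
proof (induction arbitrary: u U rule: ESG.induct)
  case (ESG_qf \<phi>)
  then show ?case
    using sub sat_quantifier_free_substructure[of A B \<phi> u U]
    by (simp add: subset_consistent_substructure_def)
next
  case (ESG_AllE \<psi> y)
  have "sat A (u(y := a)) U \<psi>" if "a \<in> dom_e A" for a
  proof (rule ESG_AllE.IH)
    show "sat B (u(y := a)) U \<psi>"
      using that sub ESG_AllE.prems(3)
      by (auto simp: subset_consistent_substructure_def substructure_def)
  qed (use that ESG_AllE.prems in auto)
  then show ?case by simp
next
  case (ESG_AllS \<psi> Y)
  have "sat A u (U(Y := S)) \<psi>" if "S \<in> dom_s A" for S
  proof (rule ESG_AllS.IH)
    show "sat B u (U(Y := S)) \<psi>"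
      using that sub ESG_AllS.prems(3)
      by (auto simp: subset_consistent_substructure_def substructure_def)
  qed (use that ESG_AllS.prems in auto)
  then show ?case by simp
next
  case (ESG_ExE \<psi> y t)
  let ?T = "eval_s A u U t"
  have A: "substructure A B" "is_mslsp_structure A" "set_pref_structure A"
    using sub by (auto simp: subset_consistent_substructure_def substructure_def)
  have t: "\<forall>x\<in>evars_sterm t. u x \<in> dom_e A" "\<forall>X\<in>svars_sterm t. U X \<in> dom_s A"
    using ESG_ExE.prems(1,2) ESG_ExE.hyps(2) by auto
  have T: "?T \<in> dom_s A" using A(2) t by (rule eval_s_in_dom)
  \<comment> \<open>As \<open>y\<close> does not occur in \<open>t\<close>, the guard set is fixed
    before a witness is chosen; hence it lies in \<open>dom_s A\<close> although the witness is so
    far only known to be in \<open>dom_e B\<close>.\<close>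
  have upd: "eval_s M (u(y := b)) U t = eval_s M u U t" for M :: "('a, 'a set) mslsp" and b
    using ESG_ExE.hyps(2) by (intro eval_s_cong) auto
  obtain b where b: "b \<in> dom_e B" "mem_rel B b ?T" "sat B (u(y := b)) U \<psi>"
    using ESG_ExE.prems(3) upd[of B] eval_s_substructure[OF A(1) t] by auto
  \<comment> \<open>\<open>mem_rel B\<close> is actual membership only on the domains of
    \<open>B\<close>.\<close>
  have "?T \<in> dom_s B" using A(1) T by (auto simp: substructure_def)
  then have "b \<in> ?T" using B b(1,2) by (simp add: set_pref_structure_def)
  then have bA: "b \<in> dom_e A" "mem_rel A b ?T"
    using A(3) T by (auto simp: set_pref_structure_def)
  have "sat A (u(y := b)) U \<psi>"
  proof (rule ESG_ExE.IH)
    show "sat B (u(y := b)) U \<psi>" by fact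
  qed (use bA(1) ESG_ExE.prems(1,2) in auto)
  then show ?case using bA upd[of A] by auto
qed auto

theorem theorem2:
  fixes A B :: "('e, 'e set) mslsp" and \<phi> :: fm
  assumes "set_pref_structure B"
    and "subset_consistent_substructure A B"
    and "ESG \<phi>"
    and "sentence \<phi>"
    and "B \<Turnstile> \<phi>"
  shows "A \<Turnstile> \<phi>"
  using assms sat_ESG_subset_consistent_substructure[OF assms(1-3)]
  by (simp add: models_def sentence_def)

end
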